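(* Let $R$ be a commutative associative ring with $1$, let $a,b\in R$, and let $m$ be a positive integer. Let $D_{2m}(a,b)$ be the symmetric Toeplitz matrix of order $2m$ over $R$ with first row $(0,a,a,b,\dots,b)$; that is, the $(i,j)$ entry is $0$ if $i=j$, is $a$ if $|i-j|\in\{1,2\}$, and is $b$ otherwise. With the convention $0^0=1$, $$ \mathrm{Hf}(D_{2m}(a,b))=\sum_{k=0}^m (a-b)^{m-k}\,b^k\,\frac{(2k)!}{k!\,2^k}\,\mu_{m-k}(\Gamma(D_{2m})), $$ where $\mu_{m-k}(\Gamma(D_{2m}))$, the number of $(m-k)$-edge matchings in the graph $\Gamma(D_{2m})$, is given by $$ \mu_{m-k}(\Gamma(D_{2m}))=\sum_{i=0}^{\min\left(m-k,\left\lfloor \frac{m+k}{2}\right\rfloor\right)}\ \sum_{p=\max(0,i-2k)}^{\min(i,m-k-i)}\binom{m+k-i}{m-k-p}\binom{m-k-p}{i}\binom{i}{p}. $$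
   Context: For a symmetric matrix $A=(a_{ij})$ of even order $n$ over a commutative associative ring, the hafnian of $A$ is $$\mathrm{Hf}(A)=\sum_{(i_1i_2|\dots|i_{n-1}i_n)} a_{i_1i_2}\cdots a_{i_{n-1}i_n},$$ where the sum ranges over all unordered partitions of the set $\{1,2,\dots,n\}$ into unordered pairs $(i_1i_2),\dots,(i_{n-1}i_n)$. The numbers $\frac{(2k)!}{k!\,2^k}$ are integers; integers act on $R$ in the usual way (as integer multiples). The convention $0^0=1$ means $x^0=1$ for every $x\in R$, including $x=0$. $D_n$ denotes the symmetric Toeplitz $(0,1)$-matrix of order $n$ with first row $(0,1,1,0,\dots,0)$, and $\Gamma(D_n)$ is the simple graph with adjacency matrix $D_n$: its vertices are $1,\dots,n$, and distinct vertices $i,j$ are adjacent iff $|i-j|\in\{1,2\}$. A $k$-edge matching in a graph is a set of $k$ pairwise nonadjacent edges (no two share a vertex). $\mu_k(\Gamma)$ denotes the number of $k$-edge matchings of the graph $\Gamma$, with $\mu_0(\Gamma)=1$. *)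

theory Defs
  imports
    "Jordan_Normal_Form.Matrix"
    "HOL-Library.Disjoint_Sets"
begin

text \<open>
  Commutative rings with 1 are rendered by the sort \<open>{comm_ring, comm_monoid_mult}\<close>. It subsumes
  \<open>comm_ring_1\<close>, whose axiom \<open>0 \<noteq> 1\<close> would exclude the zero ring. Since \<open>of_nat\<close> is not available
  at this sort, integer multiples are defined as repeated sums.
\<close>

definition nat_multiple :: "nat \<Rightarrow> 'a::comm_monoid_add \<Rightarrow> 'a" where
  "nat_multiple n x = (\<Sum>_<n. x)"

lemma nat_multiple_of_nat: "nat_multiple n x = of_nat n * (x :: 'a::semiring_1)"
  by (simp add: nat_multiple_def)

text \<open>
  Matrix rows and columns, and hence graph vertices, are numbered \<open>0, \<dots>, n - 1\<close>
  instead of \<open>1, \<dots>, n\<close>.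
\<close>

definition pair_partitions :: "'v set \<Rightarrow> 'v set set set" where
  "pair_partitions V = {P. partition_on V P \<and> (\<forall>e\<in>P. card e = 2)}"

text \<open>
  The factor of an unordered pair is read off above the diagonal, which is
  immaterial for symmetric matrices; the hafnian is meant for these (of even order) only.
\<close>

definition hafnian :: "'a::{comm_ring, comm_monoid_mult} mat \<Rightarrow> 'a" where
  "hafnian A = (\<Sum>P\<in>pair_partitions {..<dim_row A}. \<Prod>e\<in>P. A $$ (Min e, Max e))"

lemma hafnian_factor:
  assumes "A \<in> carrier_mat n n" "transpose_mat A = A" "i < n" "j < n"
  shows "A $$ (Min {i, j}, Max {i, j}) = A $$ (i, j)"
proof -
  have "A $$ (j, i) = transpose_mat A $$ (i, j)"
    using assms(1,3,4) by auto
  then have "A $$ (j, i) = A $$ (i, j)"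
    by (simp only: assms(2))
  then show ?thesis
    by (simp add: min_def max_def)
qed

text \<open>The symmetric Toeplitz matrix of order \<open>n\<close> with first row \<open>(r 0, \<dots>, r (n - 1))\<close>:\<close>

definition sym_toeplitz :: "nat \<Rightarrow> (nat \<Rightarrow> 'a) \<Rightarrow> 'a mat" where
  "sym_toeplitz n r = mat n n (\<lambda>(i, j). r (if i \<le> j then j - i else i - j))"

definition D_mat :: "nat \<Rightarrow> 'a \<Rightarrow> 'a \<Rightarrow> 'a::zero mat" where
  "D_mat n a b = sym_toeplitz n (\<lambda>d. if d = 0 then 0 else if d \<in> {1, 2} then a else b)"

lemma D_mat_carrier: "D_mat n a b \<in> carrier_mat n n"
  by (simp add: D_mat_def sym_toeplitz_def)

lemma D_mat_symmetric: "transpose_mat (D_mat n a b) = D_mat n a b"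
  by (rule eq_matI) (auto simp: D_mat_def sym_toeplitz_def)

lemma D_mat_entry:
  assumes "i < n" "j < n"
  shows "D_mat n a b $$ (i, j) =
    (if i = j then 0 else if \<bar>int i - int j\<bar> \<in> {1, 2} then a else b)"
  using assms by (auto simp: D_mat_def sym_toeplitz_def split: if_splits)

text \<open>
  A simple graph is given by its edge set, edges being two-element sets of vertices.
\<close>

definition adjacency_edges :: "nat mat \<Rightarrow> nat set set" where
  "adjacency_edges A = {{i, j} | i j. i < dim_row A \<and> j < dim_row A \<and> i \<noteq> j \<and> A $$ (i, j) = 1}"

definition Gamma_D :: "nat \<Rightarrow> nat set set" where
  "Gamma_D n = adjacency_edges (D_mat n 1 0)"

definition matchings :: "nat \<Rightarrow> 'v set set \<Rightarrow> 'v set set set" where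
  "matchings k E = {M. M \<subseteq> E \<and> finite M \<and> card M = k \<and> disjoint M}"

definition num_matchings :: "nat \<Rightarrow> 'v set set \<Rightarrow> nat" where
  "num_matchings k E = card (matchings k E)"

text \<open>The division below is exact:\<close>

lemma pairings_number_dvd: "(fact k * 2 ^ k :: nat) dvd fact (2 * k)"
proof (induction k)
  case (Suc k)
  have "(fact (2 * Suc k) :: nat) = (2 * Suc k) * ((2 * k + 1) * fact (2 * k))"
    by simp
  also have "\<dots> = (2 * Suc k) * fact (2 * k) * (2 * k + 1)"
    by (simp only: ac_simps)
  finally have *: "(fact (2 * Suc k) :: nat) = (2 * Suc k) * fact (2 * k) * (2 * k + 1)" .
  have "(fact (Suc k) * 2 ^ Suc k :: nat) = (2 * Suc k) * (fact k * 2 ^ k)"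
    by (simp add: algebra_simps)
  then show ?case
    unfolding * using Suc.IH by (metis dvd_mult2 mult_dvd_mono dvd_refl)
qed simp

definition pairings_number :: "nat \<Rightarrow> nat" where
  "pairings_number k = fact (2 * k) div (fact k * 2 ^ k)"

end

theory Submission
  imports Defs
begin

text \<open>
  Write the entries \<open>a\<close> as \<open>(a - b) + b\<close> and expand the product over a perfect pairing \<open>P\<close>: it
  becomes a sum over the matchings of the graph contained in \<open>P\<close>, where each edge of the matching
  has weight \<open>a - b\<close> and each remaining pair of \<open>P\<close> has weight \<open>b\<close>. A matching with \<open>m - k\<close> edges
  extends to \<open>(2k)! / (k! 2^k)\<close> perfect pairings, which gives the hafnian. A matching of
  \<open>\<Gamma>(D\<^sub>n)\<close> cuts the vertices into consecutive blocks of four kinds, with 1, 2, 3, 4 vertices and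
  0, 1, 1, 2 edges. Hence the matching numbers satisfy a four-term recurrence, which is also
  satisfied by sums of multinomial coefficients; the products of three binomial coefficients in the
  formula are these multinomial coefficients, \<open>i\<close> being the number of blocks with 3 or 4 vertices
  and \<open>p\<close> the number of those with 4.
\<close>

section \<open>Integer multiples and the expansion of a product of sums\<close>

lemma nat_multiple_card:
  "(\<Sum>_\<in>A. c) = nat_multiple (card A) (c :: 'a::comm_monoid_add)"
proof (cases "finite A")
  case True
  then show ?thesis
    by (induction A rule: finite_induct) (simp_all add: nat_multiple_def add.commute)
qed (simp add: nat_multiple_def)

lemma nat_multiple_mult:
  "nat_multiple (j * k) c = nat_multiple j (nat_multiple k (c :: 'a::comm_monoid_add))"
proof -
  have "nat_multiple j (nat_multiple k c) = (\<Sum>x\<in>{..<j} \<times> {..<k}. c)"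
    by (simp add: nat_multiple_def sum.cartesian_product)
  then show ?thesis
    by (simp add: nat_multiple_card)
qed

text \<open>\<open>prod_add\<close> is not applicable here, since its sort demands \<open>0 \<noteq> 1\<close>.\<close>

lemma prod_add_on_subset:
  fixes x y :: "'a::{comm_ring, comm_monoid_mult}"
  assumes "finite P"
  shows "(\<Prod>e\<in>P. if e \<in> E then x + y else y)
    = (\<Sum>M\<in>Pow (P \<inter> E). x ^ card M * y ^ (card P - card M))"
  using assms
proof (induction P rule: finite_induct)
  case empty
  show ?case by simp
next
  case (insert e P)
  let ?g = "\<lambda>P M. x ^ card M * y ^ (card P - card M)"
  \<comment> \<open>The exponent is a truncated difference, so raising it by one with
    \<open>card P\<close> requires \<open>card M\<close> \<le> \<open>card P\<close>.\<close>
  have y: "y * ?g P M = ?g (insert e P) M" if "M \<in> Pow (P \<inter> E)" for M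
  proof -
    have "card M \<le> card P"
      using that insert.hyps(1) by (intro card_mono) auto
    then show ?thesis
      using insert.hyps by (simp add: Suc_diff_le mult.left_commute)
  qed
  have x: "x * ?g P M = ?g (insert e P) (insert e M)" if "M \<in> Pow (P \<inter> E)" for M
  proof -
    have "finite M" "e \<notin> M"
      using that insert.hyps finite_subset[of M P] by auto
    then show ?thesis
      using insert.hyps by (simp add: mult.assoc)
  qed
  show ?case
  proof (cases "e \<in> E")
    case False
    then have "insert e P \<inter> E = P \<inter> E" by auto
    then show ?thesis
      using insert False y by (simp add: sum_distrib_left del: Pow_iff)
  next
    case True
    \<comment> \<open>Subsets split by whether they contain \<open>e\<close>: the factor
      \<open>y\<close> belongs to those without \<open>e\<close>, the factor \<open>x\<close> to
      those with it.\<close>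
    have eq: "Pow (insert e P \<inter> E) = Pow (P \<inter> E) \<union> insert e ` Pow (P \<inter> E)"
      using True by (simp add: Pow_insert)
    have inj: "inj_on (insert e) (Pow (P \<inter> E))"
      using insert.hyps(2) by (intro inj_onI) (auto simp: insert_eq_iff)
    have "(\<Sum>M\<in>Pow (insert e P \<inter> E). ?g (insert e P) M)
      = (\<Sum>M\<in>Pow (P \<inter> E). ?g (insert e P) M)
        + (\<Sum>M\<in>insert e ` Pow (P \<inter> E). ?g (insert e P) M)"
      unfolding eq using insert.hyps by (intro sum.union_disjoint) auto
    also have "\<dots> = (\<Sum>M\<in>Pow (P \<inter> E). y * ?g P M) + (\<Sum>M\<in>Pow (P \<inter> E). x * ?g P M)"
      by (simp add: sum.reindex[OF inj] x y del: Pow_iff Pow_Int_eq)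
    also have "\<dots> = (x + y) * (\<Sum>M\<in>Pow (P \<inter> E). ?g P M)"
      by (simp add: sum_distrib_left distrib_right sum.distrib add.commute)
    finally show ?thesis
      using insert True by simp
  qed
qed

section \<open>Counting perfect pairings\<close>

lemma finite_pair_partitions:
  assumes "finite V"
  shows "finite (pair_partitions V)"
  using finitely_many_partition_on[OF assms]
  by (rule rev_finite_subset) (auto simp: pair_partitions_def)

lemma card_Union_pairs:
  assumes "disjoint M" "\<And>e. e \<in> M \<Longrightarrow> card e = 2"
  shows "card (\<Union>M) = 2 * card M"
proof -
  have "card (\<Union>M) = (\<Sum>e\<in>M. card e)"
    using assms by (intro card_Union_disjoint) (auto intro: card_ge_0_finite simp: disjoint_def pairwise_def disjnt_def)
  then show ?thesis
    using assms(2) by simp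
qed

lemma card_pair_partition:
  assumes "P \<in> pair_partitions V"
  shows "card V = 2 * card P"
  using assms card_Union_pairs[of P] by (auto simp: pair_partitions_def partition_on_def)

text \<open>Deleting the pairs of \<open>M\<close> from a pairing is a bijection, with inverse
  adding them back.\<close>

lemma card_pair_partitions_containing:
  assumes "disjoint M" "\<And>e. e \<in> M \<Longrightarrow> card e = 2" "\<Union>M \<subseteq> V"
  shows "card {P \<in> pair_partitions V. M \<subseteq> P} = card (pair_partitions (V - \<Union>M))"
proof -
  have ne: "e \<noteq> {}" if "e \<in> M" for e
    using assms(2)[OF that] by auto
  have "bij_betw (\<lambda>P. P - M) {P \<in> pair_partitions V. M \<subseteq> P} (pair_partitions (V - \<Union>M))"
  proof (rule bij_betw_byWitness[where f' = "\<lambda>Q. Q \<union> M"])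
    show "\<forall>P\<in>{P \<in> pair_partitions V. M \<subseteq> P}. (P - M) \<union> M = P"
      by auto
    show "\<forall>Q\<in>pair_partitions (V - \<Union>M). (Q \<union> M) - M = Q"
    proof
      fix Q assume Q: "Q \<in> pair_partitions (V - \<Union>M)"
      have "Q \<inter> M = {}"
      proof (rule ccontr)
        assume "Q \<inter> M \<noteq> {}"
        then obtain e where e: "e \<in> Q" "e \<in> M" by auto
        then have "e \<subseteq> V - \<Union>M"
          using Q by (auto simp: pair_partitions_def partition_on_def)
        with e(2) ne[OF e(2)] show False by auto
      qed
      then show "(Q \<union> M) - M = Q" by auto
    qed
    show "(\<lambda>P. P - M) ` {P \<in> pair_partitions V. M \<subseteq> P} \<subseteq> pair_partitions (V - \<Union>M)"
    proof clarify
      fix P assume P: "P \<in> pair_partitions V" "M \<subseteq> P"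
      then have *: "\<Union>P = V" "disjoint P" "{} \<notin> P" "\<forall>e\<in>P. card e = 2"
        by (auto simp: pair_partitions_def partition_on_def)
      have "\<Union>(P - M) = V - \<Union>M"
      proof -
        have "\<Union>(P - M) \<inter> \<Union>M = {}"
          using *(2) P(2) by (fastforce simp: disjoint_def)
        then show ?thesis using *(1) P(2) by blast
      qed
      then show "P - M \<in> pair_partitions (V - \<Union>M)"
        using * by (auto simp: pair_partitions_def partition_on_def disjoint_def)
    qed
    show "(\<lambda>Q. Q \<union> M) ` pair_partitions (V - \<Union>M) \<subseteq> {P \<in> pair_partitions V. M \<subseteq> P}"
    proof clarify
      fix Q assume "Q \<in> pair_partitions (V - \<Union>M)"
      then have *: "\<Union>Q = V - \<Union>M" "disjoint Q" "{} \<notin> Q" "\<forall>e\<in>Q. card e = 2"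
        by (auto simp: pair_partitions_def partition_on_def)
      have "disjoint (Q \<union> M)"
        using * assms(1) by (intro disjoint_union) auto
      then show "Q \<union> M \<in> pair_partitions V \<and> M \<subseteq> Q \<union> M"
        using * assms ne[of "{}"] by (auto simp: pair_partitions_def partition_on_def)
    qed
  qed
  then show ?thesis by (rule bij_betw_same_card)
qed

lemma pairings_number_0: "pairings_number 0 = 1"
  by (simp add: pairings_number_def)

text \<open>Since the division is exact, the definition can be multiplied out; the positive factor
  \<open>fact (Suc k) * 2 ^ Suc k\<close> then cancels.\<close>

lemma pairings_number_Suc: "pairings_number (Suc k) = (2 * k + 1) * pairings_number k"
proof -
  have fact: "fact (2 * k) = pairings_number k * (fact k * 2 ^ k)" for k
    using pairings_number_dvd[of k] by (simp add: pairings_number_def)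
  have "pairings_number (Suc k) * (fact (Suc k) * 2 ^ Suc k) = fact (2 * Suc k)"
    by (rule fact[symmetric])
  also have "\<dots> = (2 * Suc k) * (2 * k + 1) * fact (2 * k)"
    by (simp add: algebra_simps)
  also have "\<dots> = (2 * k + 1) * pairings_number k * (fact (Suc k) * 2 ^ Suc k)"
    unfolding fact by (simp add: algebra_simps)
  finally show ?thesis
    by (subst (asm) mult_right_cancel) simp_all
qed

text \<open>A fixed vertex \<open>v\<close> has exactly one partner \<open>w\<close>, chosen among
  \<open>2 * k + 1\<close> vertices, and the other \<open>2 * k\<close> vertices are then paired
  freely.\<close>

lemma card_pair_partitions:
  assumes "finite V" "card V = 2 * k"
  shows "card (pair_partitions V) = pairings_number k"
  using assms
proof (induction k arbitrary: V)
  case 0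
  then have "V = {}" by simp
  then have "pair_partitions V = {{}}"
    by (auto simp: pair_partitions_def partition_on_def)
  then show ?case by (simp add: pairings_number_0)
next
  case (Suc k)
  then obtain v where v: "v \<in> V" by fastforce
  \<comment> \<open>Written as an inclusion so that \<open>card_pair_partitions_containing\<close>
    applies to the one-edge matching \<open>{{v, w}}\<close>.\<close>
  let ?A = "\<lambda>w. {P \<in> pair_partitions V. {{v, w}} \<subseteq> P}"
  have fin: "finite (pair_partitions V)"
    by (rule finite_pair_partitions) fact
  have "pair_partitions V = (\<Union>w\<in>V - {v}. ?A w)"
  proof (rule Set.equalityI)
    show "pair_partitions V \<subseteq> (\<Union>w\<in>V - {v}. ?A w)"
    proof
      fix P assume P: "P \<in> pair_partitions V"
      with v obtain e where e: "e \<in> P" "v \<in> e" "card e = 2" "e \<subseteq> V"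
        by (auto simp: pair_partitions_def partition_on_def)
      then obtain w where "e = {v, w}" "w \<noteq> v"
        by (auto simp: card_2_iff)
      then show "P \<in> (\<Union>w\<in>V - {v}. ?A w)"
        using P e by auto
    qed
  qed auto
  then have "card (pair_partitions V) = card (\<Union>w\<in>V - {v}. ?A w)"
    by simp
  also have "\<dots> = (\<Sum>w\<in>V - {v}. card (?A w))"
  proof (rule card_UN_disjoint)
    show "finite (V - {v})" using Suc.prems by simp
    show "\<forall>w\<in>V - {v}. finite (?A w)" using fin by simp
    show "\<forall>w\<in>V - {v}. \<forall>u\<in>V - {v}. w \<noteq> u \<longrightarrow> ?A w \<inter> ?A u = {}"
    proof (intro ballI impI)
      fix w u assume wu: "w \<in> V - {v}" "u \<in> V - {v}" "w \<noteq> u"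
      show "?A w \<inter> ?A u = {}"
      proof (rule ccontr)
        assume "?A w \<inter> ?A u \<noteq> {}"
        then obtain P where P: "disjoint P" "{v, w} \<in> P" "{v, u} \<in> P"
          by (auto simp: pair_partitions_def partition_on_def)
        moreover have "{v, w} \<noteq> {v, u}" using wu by (auto simp: doubleton_eq_iff)
        ultimately have "{v, w} \<inter> {v, u} = {}" by (metis disjointD)
        then show False by simp
      qed
    qed
  qed
  also have "\<dots> = (\<Sum>w\<in>V - {v}. pairings_number k)"
  proof (rule sum.cong[OF refl])
    fix w assume w: "w \<in> V - {v}"
    have "card (?A w) = card (pair_partitions (V - \<Union>{{v, w}}))"
      using v w by (intro card_pair_partitions_containing) auto
    also have "\<dots> = pairings_number k"
      using v w Suc.prems by (intro Suc.IH) (auto simp: card_Diff_subset)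
    finally show "card (?A w) = pairings_number k" .
  qed
  also have "\<dots> = pairings_number (Suc k)"
    using v Suc.prems by (simp add: pairings_number_Suc)
  finally show ?case .
qed

section \<open>The hafnian as a sum over matchings\<close>

lemma finite_matchings:
  assumes "finite E"
  shows "finite (matchings k E)"
  by (rule finite_subset[of _ "Pow E"]) (use assms in \<open>auto simp: matchings_def\<close>)

text \<open>Ordering the endpoints represents each edge by a unique pair of numbers, so questions
  about edges become inequalities.\<close>

lemma Gamma_D_altdef: "Gamma_D n = {{i, j} | i j. i < j \<and> j < n \<and> j \<le> i + 2}"
proof -
  have D: "D_mat n 1 0 $$ (i, j) = (1::nat) \<longleftrightarrow> i \<noteq> j \<and> i \<le> j + 2 \<and> j \<le> i + 2"
    if "i < n" "j < n" for i j
    using that by (auto simp: D_mat_entry)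
  have "Gamma_D n = {{i, j} | i j. i < n \<and> j < n \<and> i \<noteq> j \<and> i \<le> j + 2 \<and> j \<le> i + 2}"
    using D D_mat_carrier[of n "1::nat" 0]
    by (auto simp: Gamma_D_def adjacency_edges_def)
  also have "\<dots> = {{i, j} | i j. i < j \<and> j < n \<and> j \<le> i + 2}" (is "?L = ?R")
  proof
    show "?L \<subseteq> ?R"
    proof clarify
      fix i j :: nat
      assume *: "i < n" "j < n" "i \<noteq> j" "i \<le> j + 2" "j \<le> i + 2"
      show "\<exists>i' j'. {i, j} = {i', j'} \<and> i' < j' \<and> j' < n \<and> j' \<le> i' + 2"
      proof (cases "i < j")
        case False
        with * have "{i, j} = {j, i} \<and> j < i \<and> i < n \<and> i \<le> j + 2" by auto
        then show ?thesis by blast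
      qed (use * in blast)
    qed
    show "?R \<subseteq> ?L" by fastforce
  qed
  finally show ?thesis .
qed

lemma doubleton_in_Gamma_D:
  assumes "i < j"
  shows "{i, j} \<in> Gamma_D n \<longleftrightarrow> j < n \<and> j \<le> i + 2"
  using assms by (auto simp: Gamma_D_altdef doubleton_eq_iff)

lemma finite_Gamma_D: "finite (Gamma_D n)"
  by (rule finite_subset[of _ "Pow {..<n}"]) (auto simp: Gamma_D_altdef)

lemma pair_partition_doubleton:
  assumes "P \<in> pair_partitions {..<n::nat}" "e \<in> P"
  obtains i j where "e = {i, j}" "i < j" "j < n"
proof -
  have "card e = 2" "e \<subseteq> {..<n}"
    using assms by (auto simp: pair_partitions_def partition_on_def)
  then obtain x y where "e = {x, y}" "x \<noteq> y" "x < n" "y < n"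
    by (auto simp: card_2_iff)
  then show thesis
    using that[of x y] that[of y x] by (cases "x < y") (auto simp: insert_commute)
qed

text \<open>A pair has two distinct elements, so no diagonal entry occurs. The form
  \<open>(a - b) + b\<close> is the one that \<open>prod_add_on_subset\<close> expands.\<close>

lemma D_mat_Min_Max:
  fixes a b :: "'a::{comm_ring, comm_monoid_mult}"
  assumes "P \<in> pair_partitions {..<n}" "e \<in> P"
  shows "D_mat n a b $$ (Min e, Max e) = (if e \<in> Gamma_D n then (a - b) + b else b)"
proof -
  obtain i j where e: "e = {i, j}" "i < j" "j < n"
    using pair_partition_doubleton[OF assms] .
  then have "Min e = i" "Max e = j" by auto
  with e show ?thesis
    by (auto simp: D_mat_entry doubleton_in_Gamma_D)
qed

lemma prod_D_mat:
  fixes a b :: "'a::{comm_ring, comm_monoid_mult}"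
  assumes P: "P \<in> pair_partitions {..<2 * m}"
  shows "(\<Prod>e\<in>P. D_mat (2 * m) a b $$ (Min e, Max e))
    = (\<Sum>M\<in>Pow (P \<inter> Gamma_D (2 * m)). (a - b) ^ card M * b ^ (m - card M))"
proof -
  have card: "card P = m"
    using card_pair_partition[OF P] by simp
  have finite: "finite P"
    using P finite_elements[of "{..<2 * m}" P] by (simp add: pair_partitions_def)
  have "(\<Prod>e\<in>P. D_mat (2 * m) a b $$ (Min e, Max e))
    = (\<Prod>e\<in>P. if e \<in> Gamma_D (2 * m) then (a - b) + b else b)"
    using P by (intro prod.cong refl D_mat_Min_Max)
  also have "\<dots> = (\<Sum>M\<in>Pow (P \<inter> Gamma_D (2 * m)). (a - b) ^ card M * b ^ (m - card M))"
    using prod_add_on_subset[OF finite, of "Gamma_D (2 * m)" "a - b" b] by (simp only: card)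
  finally show ?thesis .
qed

text \<open>The members of a partition are disjoint, so the subsets of \<open>P\<close> with
  \<open>l\<close> elements, all in \<open>E\<close>, are exactly the \<open>l\<close>-edge
  matchings contained in \<open>P\<close>. The sum is grouped by \<open>l\<close>.\<close>

lemma sum_Pow_pair_partition:
  fixes g :: "nat \<Rightarrow> 'a::comm_monoid_add"
  assumes P: "P \<in> pair_partitions V" and V: "finite V" "card V = 2 * m"
  shows "(\<Sum>M\<in>Pow (P \<inter> E). g (card M)) = (\<Sum>l=0..m. \<Sum>M\<in>{M \<in> matchings l E. M \<subseteq> P}. g l)"
proof -
  have disj: "disjoint P"
    using P by (simp add: pair_partitions_def partition_on_def)
  have fin: "finite P"
    using P V(1) finite_elements[of V P] by (simp add: pair_partitions_def)
  have card_le: "card ` Pow (P \<inter> E) \<subseteq> {0..m}"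
  proof (rule image_subsetI)
    fix M assume "M \<in> Pow (P \<inter> E)"
    then have "card M \<le> card P"
      using fin by (intro card_mono) auto
    then show "card M \<in> {0..m}"
      using card_pair_partition[OF P] V(2) by simp
  qed
  have level: "{M \<in> Pow (P \<inter> E). card M = l} = {M \<in> matchings l E. M \<subseteq> P}" for l
    using disj finite_subset[OF _ fin] by (auto simp: matchings_def disjoint_def subset_iff)
  have "(\<Sum>M\<in>Pow (P \<inter> E). g (card M))
    = (\<Sum>l=0..m. \<Sum>M\<in>{M \<in> Pow (P \<inter> E). card M = l}. g (card M))"
    by (rule sum.group[symmetric]) (simp_all add: fin card_le del: Pow_Int_eq)
  also have "\<dots> = (\<Sum>l=0..m. \<Sum>M\<in>{M \<in> matchings l E. M \<subseteq> P}. g l)"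
    by (rule sum.cong[OF refl], rule sum.cong[OF level]) (simp add: matchings_def)
  finally show ?thesis .
qed

text \<open>The matching covers \<open>2 * l\<close> vertices; the remaining
  \<open>2 * (m - l)\<close> are paired freely.\<close>

lemma card_pair_partitions_containing_matching:
  assumes "finite V" "card V = 2 * m" "M \<in> matchings l E" "\<And>e. e \<in> E \<Longrightarrow> card e = 2 \<and> e \<subseteq> V"
  shows "card {P \<in> pair_partitions V. M \<subseteq> P} = pairings_number (m - l)"
proof -
  have M: "disjoint M" "card M = l" "\<And>e. e \<in> M \<Longrightarrow> card e = 2" and sub: "\<Union>M \<subseteq> V"
    using assms(3,4) by (auto simp: matchings_def)
  have "card (V - \<Union>M) = card V - card (\<Union>M)"
    using assms(1) sub by (simp add: card_Diff_subset finite_subset)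
  also have "\<dots> = 2 * (m - l)"
    using card_Union_pairs[OF M(1,3)] assms(2) M(2) by (simp add: diff_mult_distrib2)
  finally have "card (pair_partitions (V - \<Union>M)) = pairings_number (m - l)"
    using assms(1) by (simp add: card_pair_partitions)
  then show ?thesis
    by (simp add: card_pair_partitions_containing[OF M(1,3) sub])
qed

text \<open>Double counting of the incidences between pairings \<open>P\<close> and matchings
  \<open>M\<close> contained in them: the weight depends only on the size of \<open>M\<close>, and
  so does the number of \<open>P\<close> above it.\<close>

lemma hafnian_D_mat:
  fixes a b :: "'a::{comm_ring, comm_monoid_mult}"
  shows "hafnian (D_mat (2 * m) a b) =
    (\<Sum>k=0..m. nat_multiple (pairings_number k * num_matchings (m - k) (Gamma_D (2 * m)))
                 ((a - b) ^ (m - k) * b ^ k))"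
proof -
  let ?V = "{..<2 * m}" and ?E = "Gamma_D (2 * m)"
  let ?g = "\<lambda>l. (a - b) ^ l * b ^ (m - l)"
  have "dim_row (D_mat (2 * m) a b) = 2 * m"
    using D_mat_carrier[of "2 * m" a b] by simp
  then have "hafnian (D_mat (2 * m) a b)
    = (\<Sum>P\<in>pair_partitions ?V. \<Prod>e\<in>P. D_mat (2 * m) a b $$ (Min e, Max e))"
    by (simp only: hafnian_def)
  also have "\<dots> = (\<Sum>P\<in>pair_partitions ?V. \<Sum>l=0..m. \<Sum>M\<in>{M \<in> matchings l ?E. M \<subseteq> P}. ?g l)"
    by (rule sum.cong[OF refl])
      (simp only: prod_D_mat sum_Pow_pair_partition[where g = ?g, OF _ finite_lessThan card_lessThan])
  also have "\<dots> = (\<Sum>l=0..m. \<Sum>P\<in>pair_partitions ?V. \<Sum>M\<in>{M \<in> matchings l ?E. M \<subseteq> P}. ?g l)"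
    by (rule sum.swap)
  also have "\<dots> = (\<Sum>l=0..m. \<Sum>M\<in>matchings l ?E. \<Sum>P\<in>{P \<in> pair_partitions ?V. M \<subseteq> P}. ?g l)"
    by (rule sum.cong[OF refl], rule sum.swap_restrict)
      (simp_all add: finite_pair_partitions finite_matchings finite_Gamma_D)
  also have "\<dots> = (\<Sum>l=0..m. nat_multiple (pairings_number (m - l) * num_matchings l ?E) (?g l))"
  proof (rule sum.cong[OF refl])
    fix l
    have "card e = 2 \<and> e \<subseteq> ?V" if "e \<in> ?E" for e
      using that by (auto simp: Gamma_D_altdef)
    then have "card {P \<in> pair_partitions ?V. M \<subseteq> P} = pairings_number (m - l)"
      if "M \<in> matchings l ?E" for M
      using that by (intro card_pair_partitions_containing_matching) simp_all
    then show "(\<Sum>M\<in>matchings l ?E. \<Sum>P\<in>{P \<in> pair_partitions ?V. M \<subseteq> P}. ?g l)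
      = nat_multiple (pairings_number (m - l) * num_matchings l ?E) (?g l)"
      by (simp add: nat_multiple_card num_matchings_def mult.commute[of "pairings_number _"]
          nat_multiple_mult)
  qed
  also have "\<dots> = (\<Sum>k=0..m. nat_multiple (pairings_number k * num_matchings (m - k) ?E)
                 ((a - b) ^ (m - k) * b ^ k))"
    \<comment> \<open>The new index \<open>k = m - l\<close> counts the pairs outside the
      matching.\<close>
    by (rule sum.reindex_bij_witness[where i = "\<lambda>k. m - k" and j = "\<lambda>k. m - k"]) auto
  finally show ?thesis .
qed

section \<open>A recurrence for the matching numbers\<close>

lemma num_matchings_0: "num_matchings 0 E = 1"
proof -
  have "matchings 0 E = {{}}" by (auto simp: matchings_def)
  then show ?thesis by (simp add: num_matchings_def)
qed

lemma num_matchings_empty: "num_matchings (Suc k) {} = 0"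
  by (auto simp: num_matchings_def matchings_def)

text \<open>A matching either avoids \<open>e\<close>, or consists of \<open>e\<close> and a
  matching of the edges disjoint from \<open>e\<close>.\<close>

lemma num_matchings_insert:
  assumes "finite E" "e \<notin> E" "e \<noteq> {}"
  shows "num_matchings (Suc k) (insert e E)
    = num_matchings (Suc k) E + num_matchings k {f \<in> E. f \<inter> e = {}}"
proof -
  let ?F = "{f \<in> E. f \<inter> e = {}}"
  have eq: "matchings (Suc k) (insert e E) = matchings (Suc k) E \<union> insert e ` matchings k ?F"
  proof (intro Set.equalityI subsetI)
    fix M assume M: "M \<in> matchings (Suc k) (insert e E)"
    show "M \<in> matchings (Suc k) E \<union> insert e ` matchings k ?F"
    proof (cases "e \<in> M")
      case False
      with M show ?thesis by (auto simp: matchings_def)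
    next
      case True
      have "M - {e} \<in> matchings k ?F"
        using M True by (auto simp: matchings_def disjoint_def)
      moreover have "M = insert e (M - {e})" using True by auto
      ultimately show ?thesis by blast
    qed
  next
    fix M assume "M \<in> matchings (Suc k) E \<union> insert e ` matchings k ?F"
    then show "M \<in> matchings (Suc k) (insert e E)"
    proof
      assume "M \<in> insert e ` matchings k ?F"
      then obtain N where N: "M = insert e N" "N \<in> matchings k ?F" by auto
      have "e \<notin> N" using N(2) assms(2) by (auto simp: matchings_def)
      moreover have "disjoint (insert e N)"
        using N(2) by (auto simp: matchings_def disjoint_def)
      ultimately show ?thesis
        using N by (auto simp: matchings_def)
    qed (auto simp: matchings_def)
  qed
  have notin: "e \<notin> N" if "N \<in> matchings k ?F" for N
    using that assms(2) by (auto simp: matchings_def)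
  have inj: "inj_on (insert e) (matchings k ?F)"
    by (rule inj_onI) (simp add: insert_ident notin)
  have disj: "matchings (Suc k) E \<inter> insert e ` matchings k ?F = {}"
    using assms(2) by (auto simp: matchings_def)
  have "card (matchings (Suc k) (insert e E))
    = card (matchings (Suc k) E) + card (insert e ` matchings k ?F)"
    unfolding eq using disj assms(1)
    by (intro card_Un_disjoint finite_imageI finite_matchings) auto
  then show ?thesis
    by (simp add: num_matchings_def card_image[OF inj])
qed

lemma Gamma_D_le_1: "n \<le> 1 \<Longrightarrow> Gamma_D n = {}"
  by (auto simp: Gamma_D_altdef)

text \<open>Identities between edge sets can thus be proved as identities between sets of ordered
  index pairs, where plain arithmetic suffices.\<close>

lemma Gamma_D_image: "Gamma_D n = (\<lambda>(i, j). {i, j}) ` {(i, j). i < j \<and> j < n \<and> j \<le> i + 2}"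
  by (auto simp: Gamma_D_altdef image_iff)

text \<open>Of the edges at the top vertex \<open>n\<close>, first \<open>{n - 1, n}\<close> and then \<open>{n - 2, n}\<close> is split off. The
  edges disjoint from the former form \<open>Gamma_D (n - 1)\<close>; those disjoint from the latter form
  \<open>Gamma_D (n - 2)\<close> together with the extra edge \<open>{n - 3, n - 1}\<close>, which is split off in turn.\<close>

lemma num_matchings_Gamma_D_Suc:
  "num_matchings (Suc k) (Gamma_D (Suc n)) = num_matchings (Suc k) (Gamma_D n)
    + (if 1 \<le> n then num_matchings k (Gamma_D (n - 1)) else 0)
    + (if 2 \<le> n then num_matchings k (Gamma_D (n - 2)) else 0)
    + (if 3 \<le> n \<and> 1 \<le> k then num_matchings (k - 1) (Gamma_D (n - 3)) else 0)"
proof -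
  consider "n = 0" | "n = 1" | m where "n = m + 2"
    by (metis One_nat_def add_2_eq_Suc' not0_implies_Suc)
  then show ?thesis
  proof cases
    case 1
    then show ?thesis by (simp add: Gamma_D_le_1)
  next
    case 2
    have "{(i, j). i < j \<and> j < Suc 1 \<and> j \<le> i + (2::nat)} = {(0, 1)}"
      by auto
    then have "Gamma_D (Suc 1) = insert {0, 1} {}"
      unfolding Gamma_D_image by simp
    then show ?thesis
      using 2 num_matchings_insert[of "{}" "{0, 1::nat}" k] by (simp add: Gamma_D_le_1)
  next
    \<comment> \<open>Here \<open>n = m + 2\<close>, so the top vertex of
      \<open>Gamma_D (Suc n)\<close> is \<open>m + 2\<close>, and the condition \<open>3\<close>
      \<le> \<open>n\<close> reads \<open>1\<close> \<le> \<open>m\<close>.\<close>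
    case (3 m)
    let ?g = "\<lambda>(i, j). {i, j :: nat}"
    let ?S = "\<lambda>n. {(i, j). i < j \<and> j < n \<and> j \<le> i + (2::nat)}"
    have filter: "{f \<in> ?g ` S. Q f} = ?g ` {x \<in> S. Q (?g x)}" for S Q
      by auto
    have top: "Gamma_D (m + 3) = insert {m + 1, m + 2} (insert {m, m + 2} (Gamma_D (m + 2)))"
    proof -
      have "?S (m + 3) = insert (m + 1, m + 2) (insert (m, m + 2) (?S (m + 2)))"
        by auto
      then show ?thesis by (simp add: Gamma_D_image)
    qed
    have top_disjoint:
      "{f \<in> insert {m, m + 2} (Gamma_D (m + 2)). f \<inter> {m + 1, m + 2} = {}} = Gamma_D (m + 1)"
    proof -
      have "{f \<in> insert {m, m + 2} (Gamma_D (m + 2)). f \<inter> {m + 1, m + 2} = {}}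
        = {f \<in> Gamma_D (m + 2). f \<inter> {m + 1, m + 2} = {}}"
        by auto
      also have "\<dots> = ?g ` {x \<in> ?S (m + 2). ?g x \<inter> {m + 1, m + 2} = {}}"
        unfolding Gamma_D_image by (rule filter)
      also have "{x \<in> ?S (m + 2). ?g x \<inter> {m + 1, m + 2} = {}} = ?S (m + 1)"
        by auto
      finally show ?thesis by (simp add: Gamma_D_image)
    qed
    \<comment> \<open>Without \<open>m\<close>, vertex \<open>m + 1\<close> keeps only its neighbour
      \<open>m - 1\<close>, which exists only for \<open>m\<close> \<ge> \<open>1\<close>.\<close>
    have next_disjoint: "{f \<in> Gamma_D (m + 2). f \<inter> {m, m + 2} = {}}
      = (if 1 \<le> m then insert {m - 1, m + 1} (Gamma_D m) else Gamma_D m)"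
    proof -
      have "{f \<in> Gamma_D (m + 2). f \<inter> {m, m + 2} = {}}
        = ?g ` {x \<in> ?S (m + 2). ?g x \<inter> {m, m + 2} = {}}"
        unfolding Gamma_D_image by (rule filter)
      also have "{x \<in> ?S (m + 2). ?g x \<inter> {m, m + 2} = {}}
        = (if 1 \<le> m then insert (m - 1, m + 1) (?S m) else ?S m)"
        by auto
      finally show ?thesis by (auto simp: Gamma_D_image)
    qed
    \<comment> \<open>This also holds for \<open>m = 0\<close>, where \<open>m - 1\<close> is
      \<open>0\<close> and both sides are empty.\<close>
    have last_disjoint: "{f \<in> Gamma_D m. f \<inter> {m - 1, m + 1} = {}} = Gamma_D (m - 1)"
    proof -
      have "{f \<in> Gamma_D m. f \<inter> {m - 1, m + 1} = {}}
        = ?g ` {x \<in> ?S m. ?g x \<inter> {m - 1, m + 1} = {}}"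
        unfolding Gamma_D_image by (rule filter)
      also have "{x \<in> ?S m. ?g x \<inter> {m - 1, m + 1} = {}} = ?S (m - 1)"
        by auto
      finally show ?thesis by (simp add: Gamma_D_image)
    qed
    have "num_matchings (Suc k) (Gamma_D (m + 3))
      = num_matchings (Suc k) (insert {m, m + 2} (Gamma_D (m + 2)))
        + num_matchings k (Gamma_D (m + 1))"
      unfolding top top_disjoint[symmetric]
      by (rule num_matchings_insert)
        (auto simp: finite_Gamma_D doubleton_in_Gamma_D doubleton_eq_iff)
    also have "num_matchings (Suc k) (insert {m, m + 2} (Gamma_D (m + 2)))
      = num_matchings (Suc k) (Gamma_D (m + 2))
        + num_matchings k (if 1 \<le> m then insert {m - 1, m + 1} (Gamma_D m) else Gamma_D m)"
      unfolding next_disjoint[symmetric]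
      by (rule num_matchings_insert)
        (auto simp: finite_Gamma_D doubleton_in_Gamma_D)
    also have "num_matchings k (if 1 \<le> m then insert {m - 1, m + 1} (Gamma_D m) else Gamma_D m)
      = num_matchings k (Gamma_D m)
        + (if 1 \<le> m \<and> 1 \<le> k then num_matchings (k - 1) (Gamma_D (m - 1)) else 0)"
    \<comment> \<open>For \<open>k = 0\<close> only the empty matching counts, with or without the
      extra edge.\<close>
    proof (cases k)
      case (Suc l)
      have "num_matchings (Suc l) (insert {m - 1, m + 1} (Gamma_D m))
        = num_matchings (Suc l) (Gamma_D m) + num_matchings l (Gamma_D (m - 1))"
        unfolding last_disjoint[symmetric]
        by (rule num_matchings_insert)
          (auto simp: finite_Gamma_D doubleton_in_Gamma_D)
      then show ?thesis using Suc by simp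
    qed (simp add: num_matchings_0)
    finally show ?thesis
      using 3 by (simp add: numeral_3_eq_3)
  qed
qed

section \<open>Multinomial solution of the recurrence\<close>

text \<open>Number of words with \<open>s\<close>, \<open>d\<close>, \<open>t\<close>, \<open>q\<close> occurrences of four letters. The letters stand for the
  blocks into which a matching cuts the vertices: an unmatched vertex, an edge \<open>{v, v + 1}\<close>, an edge
  \<open>{v, v + 2}\<close> around an unmatched vertex, and a pair of edges \<open>{v, v + 2}\<close>, \<open>{v + 1, v + 3}\<close>.\<close>

definition block_words :: "nat \<Rightarrow> nat \<Rightarrow> nat \<Rightarrow> nat \<Rightarrow> nat" where
  "block_words s d t q =
    ((s + d + t + q) choose (d + t + q)) * ((d + t + q) choose (t + q)) * ((t + q) choose q)"

text \<open>Pascal's rule for words in two letters; the guards exclude the cases in which a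
  predecessor would be truncated.\<close>

lemma choose_add_rec:
  assumes "0 < x + y"
  shows "(x + y) choose y =
    (if 0 < x then (x - 1 + y) choose y else 0) + (if 0 < y then (x + (y - 1)) choose (y - 1) else 0)"
  using assms by (cases x; cases y) auto

text \<open>A nonempty word is classified by its last letter. Algebraically, Pascal's rule is
  applied to the three binomial coefficients in turn, splitting off one letter each time.\<close>

lemma block_words_rec:
  assumes "0 < s + d + t + q"
  shows "block_words s d t q =
    (if 0 < s then block_words (s - 1) d t q else 0) + (if 0 < d then block_words s (d - 1) t q else 0)
    + (if 0 < t then block_words s d (t - 1) q else 0) + (if 0 < q then block_words s d t (q - 1) else 0)"
proof (cases "d + t + q = 0")
  case True
  then show ?thesis using assms by (simp add: block_words_def)
next
  case pos: False
  \<comment> \<open>Lowering any one of \<open>d\<close>, \<open>t\<close>, \<open>q\<close> gives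
    the same first factor \<open>?s\<close>; lowering \<open>t\<close> or \<open>q\<close> gives the
    same second factor \<open>?d\<close>.\<close>
  let ?s = "(s + (d + t + q - 1)) choose (d + t + q - 1)"
  let ?d = "(d + (t + q - 1)) choose (t + q - 1)"
  have s: "block_words s d t q = (if 0 < s then block_words (s - 1) d t q else 0)
    + ?s * ((d + (t + q)) choose (t + q)) * ((t + q) choose q)"
    using choose_add_rec[of s "d + t + q"] pos
    by (simp add: block_words_def add_mult_distrib add.assoc)
  show ?thesis
  proof (cases "t + q = 0")
    case True
    then show ?thesis using s pos by (simp add: block_words_def)
  next
    case False
    have d: "?s * ((d + (t + q)) choose (t + q)) * ((t + q) choose q)
      = (if 0 < d then block_words s (d - 1) t q else 0) + ?s * ?d * ((t + q) choose q)"
    proof (cases d)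
      case 0
      then show ?thesis by simp
    next
      case (Suc d')
      then show ?thesis
        using choose_add_rec[of d "t + q"] False
        by (simp add: block_words_def add_mult_distrib add_mult_distrib2 add.assoc)
    qed
    have t: "?s * ?d * ((t + q) choose q)
      = (if 0 < t then block_words s d (t - 1) q else 0)
        + (if 0 < q then block_words s d t (q - 1) else 0)"
      using choose_add_rec[of t q] False
      by (cases t; cases q) (simp_all add: block_words_def add_mult_distrib2 add.assoc)
    show ?thesis
      unfolding s d t by (simp only: add.assoc)
  qed
qed

text \<open>The coefficients are the numbers of vertices and of edges in the four kinds of
  blocks.\<close>

definition block_counts :: "nat \<Rightarrow> nat \<Rightarrow> (nat \<times> nat \<times> nat \<times> nat) set" where
  "block_counts n j = {(s, d, t, q). s + 2 * d + 3 * t + 4 * q = n \<and> d + t + 2 * q = j}"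

definition block_sum :: "nat \<Rightarrow> nat \<Rightarrow> nat" where
  "block_sum n j = (\<Sum>(s, d, t, q)\<in>block_counts n j. block_words s d t q)"

lemma finite_block_counts: "finite (block_counts n j)"
  by (rule finite_subset[of _ "{..n} \<times> {..n} \<times> {..n} \<times> {..n}"]) (auto simp: block_counts_def)

lemma block_sum_0: "block_sum n 0 = 1"
proof -
  have "block_counts n 0 = {(n, 0, 0, 0)}" by (auto simp: block_counts_def)
  then show ?thesis by (simp add: block_sum_def block_words_def)
qed

lemma block_sum_0_left: "block_sum 0 (Suc j) = 0"
proof -
  have "block_counts 0 (Suc j) = {}" by (auto simp: block_counts_def)
  then show ?thesis by (simp add: block_sum_def)
qed

text \<open>Removing the last block takes away 1, 2, 3 or 4 vertices and 0, 1, 1 or 2 edges. The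
  result is the recurrence of \<open>num_matchings_Gamma_D_Suc\<close>.\<close>

lemma block_sum_Suc:
  "block_sum (Suc n) (Suc k) = block_sum n (Suc k)
    + (if 1 \<le> n then block_sum (n - 1) k else 0)
    + (if 2 \<le> n then block_sum (n - 2) k else 0)
    + (if 3 \<le> n \<and> 1 \<le> k then block_sum (n - 3) (k - 1) else 0)"
proof -
  let ?S = "block_counts (Suc n) (Suc k)"
  let ?sum = "\<lambda>Q f. \<Sum>x\<in>{x \<in> ?S. Q x}. f x"
  have "block_sum (Suc n) (Suc k) = (\<Sum>(s, d, t, q)\<in>?S.
    (if 0 < s then block_words (s - 1) d t q else 0) + (if 0 < d then block_words s (d - 1) t q else 0)
    + (if 0 < t then block_words s d (t - 1) q else 0) + (if 0 < q then block_words s d t (q - 1) else 0))"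
    unfolding block_sum_def
  proof (rule sum.cong[OF refl], clarify)
    fix s d t q assume "(s, d, t, q) \<in> ?S"
    then have "0 < s + d + t + q" by (auto simp: block_counts_def)
    then show "block_words s d t q =
      (if 0 < s then block_words (s - 1) d t q else 0) + (if 0 < d then block_words s (d - 1) t q else 0)
      + (if 0 < t then block_words s d (t - 1) q else 0) + (if 0 < q then block_words s d t (q - 1) else 0)"
      by (rule block_words_rec)
  qed
  also have "\<dots> = ?sum (\<lambda>(s, d, t, q). 0 < s) (\<lambda>(s, d, t, q). block_words (s - 1) d t q)
    + ?sum (\<lambda>(s, d, t, q). 0 < d) (\<lambda>(s, d, t, q). block_words s (d - 1) t q)
    + ?sum (\<lambda>(s, d, t, q). 0 < t) (\<lambda>(s, d, t, q). block_words s d (t - 1) q)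
    + ?sum (\<lambda>(s, d, t, q). 0 < q) (\<lambda>(s, d, t, q). block_words s d t (q - 1))"
    by (simp add: sum.inter_filter[OF finite_block_counts] split_def sum.distrib del: One_nat_def)
  also have "?sum (\<lambda>(s, d, t, q). 0 < s) (\<lambda>(s, d, t, q). block_words (s - 1) d t q)
    = block_sum n (Suc k)"
    unfolding block_sum_def
    by (rule sum.reindex_bij_witness[where i = "\<lambda>(s, d, t, q). (s + 1, d, t, q)"
          and j = "\<lambda>(s, d, t, q). (s - 1, d, t, q)"])
      (auto simp: block_counts_def)
  also have "?sum (\<lambda>(s, d, t, q). 0 < d) (\<lambda>(s, d, t, q). block_words s (d - 1) t q)
    = (if 1 \<le> n then block_sum (n - 1) k else 0)"
  proof (cases "1 \<le> n")
    case True
    then show ?thesis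
      unfolding block_sum_def if_P[OF True]
      by (intro sum.reindex_bij_witness[where i = "\<lambda>(s, d, t, q). (s, d + 1, t, q)"
            and j = "\<lambda>(s, d, t, q). (s, d - 1, t, q)"])
        (auto simp: block_counts_def)
  next
    case False
    \<comment> \<open>The block does not fit, so no index has this letter; the same argument settles
      the two cases below.\<close>
    then have "{x \<in> ?S. case x of (s, d, t, q) \<Rightarrow> 0 < d} = {}" by (auto simp: block_counts_def)
    with False show ?thesis by (simp only: sum.empty if_False)
  qed
  also have "?sum (\<lambda>(s, d, t, q). 0 < t) (\<lambda>(s, d, t, q). block_words s d (t - 1) q)
    = (if 2 \<le> n then block_sum (n - 2) k else 0)"
  proof (cases "2 \<le> n")
    case True
    then show ?thesis
      unfolding block_sum_def if_P[OF True]
      by (intro sum.reindex_bij_witness[where i = "\<lambda>(s, d, t, q). (s, d, t + 1, q)"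
            and j = "\<lambda>(s, d, t, q). (s, d, t - 1, q)"])
        (auto simp: block_counts_def)
  next
    case False
    then have "{x \<in> ?S. case x of (s, d, t, q) \<Rightarrow> 0 < t} = {}" by (auto simp: block_counts_def)
    with False show ?thesis by (simp only: sum.empty if_False)
  qed
  also have "?sum (\<lambda>(s, d, t, q). 0 < q) (\<lambda>(s, d, t, q). block_words s d t (q - 1))
    = (if 3 \<le> n \<and> 1 \<le> k then block_sum (n - 3) (k - 1) else 0)"
  proof (cases "3 \<le> n \<and> 1 \<le> k")
    case True
    then show ?thesis
      unfolding block_sum_def if_P[OF True]
      by (intro sum.reindex_bij_witness[where i = "\<lambda>(s, d, t, q). (s, d, t, q + 1)"
            and j = "\<lambda>(s, d, t, q). (s, d, t, q - 1)"])
        (auto simp: block_counts_def)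
  next
    case False
    then have "{x \<in> ?S. case x of (s, d, t, q) \<Rightarrow> 0 < q} = {}" by (auto simp: block_counts_def)
    with False show ?thesis by (simp only: sum.empty if_False)
  qed
  finally show ?thesis .
qed

text \<open>Both sides satisfy the same recurrence with the same initial values. The induction is
  strong because the recurrence reaches back four orders.\<close>

lemma num_matchings_Gamma_D: "num_matchings k (Gamma_D n) = block_sum n k"
proof (induction n arbitrary: k rule: less_induct)
  case (less n)
  show ?case
  proof (cases k)
    case 0
    then show ?thesis by (simp add: num_matchings_0 block_sum_0)
  next
    case k: (Suc l)
    show ?thesis
    proof (cases n)
      case 0
      then show ?thesis using k by (simp add: Gamma_D_le_1 num_matchings_empty block_sum_0_left)
    next
      case (Suc n')
      then have IH: "num_matchings j (Gamma_D n'') = block_sum n'' j" if "n'' \<le> n'" for n'' j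
        using that by (simp add: less.IH)
      show ?thesis
        unfolding k Suc num_matchings_Gamma_D_Suc block_sum_Suc by (simp add: IH)
    qed
  qed
qed

section \<open>From block counts to the double sum\<close>

text \<open>The two equations in \<open>block_counts\<close> leave two free parameters,
  \<open>i = t + q\<close> and \<open>p = q\<close>. The bounds on \<open>i\<close> and
  \<open>p\<close> express that the resulting \<open>s\<close>, \<open>d\<close>, \<open>t\<close>,
  \<open>q\<close> are nonnegative.\<close>

lemma block_sum_Sigma:
  assumes "k \<le> m"
  shows "block_sum (2 * m) (m - k) =
    (\<Sum>(i, p)\<in>(SIGMA i:{0..min (m - k) ((m + k) div 2)}. {max 0 (i - 2 * k)..min i (m - k - i)}).
      ((m + k - i) choose (m - k - p)) * ((m - k - p) choose i) * (i choose p))"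
proof -
  let ?I = "{0..min (m - k) ((m + k) div 2)}"
  let ?J = "\<lambda>i. {max 0 (i - 2 * k)..min i (m - k - i)}"
  let ?f = "\<lambda>i p. ((m + k - i) choose (m - k - p)) * ((m - k - p) choose i) * (i choose p)"
  show ?thesis
    unfolding block_sum_def
  proof (rule sum.reindex_bij_witness[
        where i = "\<lambda>(i, p). (2 * k + p - i, m - k - p - i, i - p, p)"
          and j = "\<lambda>(s, d, t, q). (t + q, q)"])
    fix x assume "x \<in> block_counts (2 * m) (m - k)"
    then obtain s d t q where x: "x = (s, d, t, q)"
      and *: "s + 2 * d + 3 * t + 4 * q = 2 * m" "d + t + 2 * q = m - k"
      by (auto simp: block_counts_def)
    \<comment> \<open>Subtracting twice the edge count from the vertex count leaves
      \<open>s + t\<close>, the number of unmatched vertices.\<close>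
    have s: "2 * k = s + t" and mk: "m = d + t + 2 * q + k"
      using * assms by linarith+
    show "(case case x of (s, d, t, q) \<Rightarrow> (t + q, q) of
      (i, p) \<Rightarrow> (2 * k + p - i, m - k - p - i, i - p, p)) = x"
      using s mk by (simp add: x)
    show "(case x of (s, d, t, q) \<Rightarrow> (t + q, q)) \<in> Sigma ?I ?J"
      using s mk by (simp add: x)
    have "m + k - (t + q) = s + d + t + q" "m - k - q = d + t + q"
      using s mk by linarith+
    then show "(case case x of (s, d, t, q) \<Rightarrow> (t + q, q) of (i, p) \<Rightarrow> ?f i p)
      = (case x of (s, d, t, q) \<Rightarrow> block_words s d t q)"
      by (simp add: x block_words_def)
  next
    fix y assume "y \<in> Sigma ?I ?J"
    then obtain i p where y: "y = (i, p)"
      and *: "i \<le> m - k" "i - 2 * k \<le> p" "p \<le> i" "p \<le> m - k - i"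
      by auto
    show "(case case y of (i, p) \<Rightarrow> (2 * k + p - i, m - k - p - i, i - p, p) of
      (s, d, t, q) \<Rightarrow> (t + q, q)) = y"
      unfolding y using \<open>p \<le> i\<close> by (simp only: prod.case le_add_diff_inverse2)
    \<comment> \<open>Naming the differences \<open>t\<close>, \<open>d\<close>, \<open>s\<close>
      replaces truncated subtractions by sums.\<close>
    obtain t where t: "i = p + t"
      using \<open>p \<le> i\<close> le_Suc_ex by blast
    obtain d where "m - k - i = p + d"
      using *(4) le_Suc_ex by blast
    then have d: "m - k = d + t + 2 * p"
      using *(1) by (simp add: t)
    then have m: "m = d + t + 2 * p + k"
      using assms by simp
    have "t \<le> 2 * k"
      using *(2) by (simp add: t)
    then obtain s where k: "2 * k = s + t"
      using le_Suc_ex add.commute by metis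
    have "2 * k + p - i = s" "m - k - p - i = d" "i - p = t"
      unfolding k d t by simp_all
    moreover have "s + 2 * d + 3 * t + 4 * p = 2 * m"
      using k by (simp add: m)
    ultimately show "(case y of (i, p) \<Rightarrow> (2 * k + p - i, m - k - p - i, i - p, p))
      \<in> block_counts (2 * m) (m - k)"
      using d by (simp only: y block_counts_def prod.case mem_Collect_eq simp_thms)
  qed
qed

theorem theorem3:
  fixes a b :: "'a::{comm_ring, comm_monoid_mult}" and m :: nat
  assumes "m > 0"
  shows "hafnian (D_mat (2 * m) a b) =
      (\<Sum>k=0..m. nat_multiple (pairings_number k * num_matchings (m - k) (Gamma_D (2 * m)))
                   ((a - b) ^ (m - k) * b ^ k))
    \<and> (\<forall>k\<le>m. num_matchings (m - k) (Gamma_D (2 * m)) =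
      (\<Sum>i=0..min (m - k) ((m + k) div 2).
        \<Sum>p=max 0 (i - 2 * k)..min i (m - k - i).
          ((m + k - i) choose (m - k - p)) * ((m - k - p) choose i) * (i choose p)))"
proof (intro conjI allI impI)
  fix k assume "k \<le> m"
  from block_sum_Sigma[OF this]
  show "num_matchings (m - k) (Gamma_D (2 * m)) =
      (\<Sum>i=0..min (m - k) ((m + k) div 2).
        \<Sum>p=max 0 (i - 2 * k)..min i (m - k - i).
          ((m + k - i) choose (m - k - p)) * ((m - k - p) choose i) * (i choose p))"
    by (simp add: num_matchings_Gamma_D sum.Sigma)
qed (rule hafnian_D_mat)

end
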